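(* Let $\mathcal G$ be a finite call graph over a junction network $\mathcal J^\star(\mathcal A)$, let $P\in\mathcal G$ be a flow and let $\sigma$ be a parameter assignment. Then the trace $T(\mathcal G,P,\sigma)$ is a finite tree (its recursive computation terminates).
   Context: $\omega$-terms are built from $\bar 0$, $s$, parameters (variables of sort $\omega$) and primitive-recursively defined numeric function symbols; $\mathcal S$ is the set of all parameter assignments (maps from parameters to numerals), and $\sigma(t){\downarrow_\omega}$ is the numeral value of $t$ under $\sigma$ (applied componentwise to tuples). A point of length $m$ is an $m$-tuple of $\omega$-terms. For each $m$, $\prec_m$ is a well-founded total order on $m$-tuples of numerals; for $S\subseteq\mathcal S$ and points $\mathbf v,\mathbf v'$ of length $m$, $\mathbf v\prec^S_m\mathbf v'$ iff $\sigma(\mathbf v){\downarrow_\omega}\prec_m\sigma(\mathbf v'){\downarrow_\omega}$ for every $\sigma\in S$. $\Delta$ is a countably infinite set of symbols and $\mathcal A\colon\Delta\to\mathbb N$ an arity function; an $\mathcal A$-junction is a pair $(\delta,p)$ with $p$ a point of length $\mathcal A(\delta)$, and $\mathcal J^\star(\mathcal A)$ is the set of all $\mathcal A$-junctions. Network order: $(\delta,p)\prec^S(\delta',q)$ iff either $p\prec^S_{\mathcal A(\delta)}q$, or $\mathcal A(\delta')<\mathcal A(\delta)$. A flow is given by a partition $\mathcal S^*$ of $\mathcal S$ into mutually disjoint sets and an injective map $P$ from $\mathcal S^*$ to finite subsets of $\mathcal J^\star(\mathcal A)$ such that (1) there is a unique junction $[P]$, the source, with $[P]\in P(S)$ for all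 $S\in\mathcal S^*$, and (2) for all $S\in\mathcal S^*$ and $q\in P(S)$, $q\prec^S[P]$ or $q=[P]$. A call graph is a finite set $\mathcal G$ of flows such that for every $P_1\in\mathcal G$ (with partition $\mathcal S^*_1$), every $S\in\mathcal S^*_1$, every $\sigma\in S$ and every $j\in P_1(S)$ there exist a unique $P_2\in\mathcal G$ and a parameter assignment $\theta$ with $\theta([P_2]){\downarrow_\omega}=\sigma(j){\downarrow_\omega}$ (applied to the points, symbols equal); write $\mathrm{flow}(j,\sigma)=P_2$ and $\mathrm{subst}(j,\sigma)=\theta$. An $\mathcal A$-trace is a pair $[j,\mathcal T]$ of a junction $j$ and a set $\mathcal T$ of $\mathcal A$-traces. For $P\in\mathcal G$ with partition $\mathcal S^*$, $\sigma\in S\in\mathcal S^*$, the trace is defined recursively by $T(\mathcal G,P,\sigma)=\big[\sigma([P]){\downarrow_\omega},\ \bigcup_{j\in P(S)\setminus\{[P]\}}T(\mathcal G,\mathrm{flow}(j,\sigma),\mathrm{subst}(j,\sigma))\big]$. *)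

theory Defs
  imports Main "HOL-Library.Disjoint_Sets" "HOL-Library.Countable_Set_Type"
begin

text \<open>A primitive-recursively defined function symbol is represented by its own definition.
  The first component of \<open>PR_Proj\<close> and \<open>PR_Comp\<close> is the arity of the defined function, and
  \<open>PR_Rec g h\<close> is the function \<open>f\<close> with \<open>f(0, ys) = g(ys)\<close> and
  \<open>f(s(n), ys) = h(n, f(n, ys), ys)\<close>.\<close>

datatype pr_sym =
    PR_Zero
  | PR_Suc
  | PR_Proj nat nat
  | PR_Comp nat pr_sym "pr_sym list"
  | PR_Rec pr_sym pr_sym

fun pr_arity :: "pr_sym \<Rightarrow> nat" where
  "pr_arity PR_Zero = 0"
| "pr_arity PR_Suc = 1"
| "pr_arity (PR_Proj n i) = n"
| "pr_arity (PR_Comp n f gs) = n"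
| "pr_arity (PR_Rec g h) = Suc (pr_arity g)"

fun pr_wf :: "pr_sym \<Rightarrow> bool" where
  "pr_wf PR_Zero \<longleftrightarrow> True"
| "pr_wf PR_Suc \<longleftrightarrow> True"
| "pr_wf (PR_Proj n i) \<longleftrightarrow> i < n"
| "pr_wf (PR_Comp n f gs) \<longleftrightarrow>
     pr_wf f \<and> pr_arity f = length gs \<and> (\<forall>g\<in>set gs. pr_wf g \<and> pr_arity g = n)"
| "pr_wf (PR_Rec g h) \<longleftrightarrow> pr_wf g \<and> pr_wf h \<and> pr_arity h = pr_arity g + 2"

fun pr_eval :: "pr_sym \<Rightarrow> nat list \<Rightarrow> nat" where
  "pr_eval PR_Zero xs = 0"
| "pr_eval PR_Suc xs = Suc (hd xs)"
| "pr_eval (PR_Proj n i) xs = xs ! i"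
| "pr_eval (PR_Comp n f gs) xs = pr_eval f (map (\<lambda>g. pr_eval g xs) gs)"
| "pr_eval (PR_Rec g h) xs =
     rec_nat (pr_eval g (tl xs)) (\<lambda>n r. pr_eval h (n # r # tl xs)) (hd xs)"

datatype 'v oterm =
    OZero
  | OSuc "'v oterm"
  | OParam 'v
  | OApp pr_sym "'v oterm list"

fun oterm_wf :: "'v oterm \<Rightarrow> bool" where
  "oterm_wf OZero \<longleftrightarrow> True"
| "oterm_wf (OSuc t) \<longleftrightarrow> oterm_wf t"
| "oterm_wf (OParam x) \<longleftrightarrow> True"
| "oterm_wf (OApp f ts) \<longleftrightarrow> pr_wf f \<and> length ts = pr_arity f \<and> (\<forall>t\<in>set ts. oterm_wf t)"

text \<open>Numerals are identified with natural numbers; \<open>onum n\<close> is the numeral as a term.\<close>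

type_synonym 'v assignment = "'v \<Rightarrow> nat"

fun oeval :: "'v assignment \<Rightarrow> 'v oterm \<Rightarrow> nat" where
  "oeval \<sigma> OZero = 0"
| "oeval \<sigma> (OSuc t) = Suc (oeval \<sigma> t)"
| "oeval \<sigma> (OParam x) = \<sigma> x"
| "oeval \<sigma> (OApp f ts) = pr_eval f (map (oeval \<sigma>) ts)"

definition onum :: "nat \<Rightarrow> 'v oterm" where
  "onum n = (OSuc ^^ n) OZero"


type_synonym 'v point = "'v oterm list"
type_synonym ('d, 'v) junction = "'d \<times> 'v point"

definition wf_total_order_on :: "'a set \<Rightarrow> ('a \<Rightarrow> 'a \<Rightarrow> bool) \<Rightarrow> bool" where
  "wf_total_order_on X R \<longleftrightarrow>
     irreflp_on X R \<and> transp_on X R \<and> totalp_on X R \<and> wfp_on X R"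

definition is_point :: "nat \<Rightarrow> 'v point \<Rightarrow> bool" where
  "is_point m p \<longleftrightarrow> length p = m \<and> (\<forall>t\<in>set p. oterm_wf t)"

definition junctions :: "('d \<Rightarrow> nat) \<Rightarrow> ('d, 'v) junction set" where
  "junctions \<A> = {(\<delta>, p). is_point (\<A> \<delta>) p}"

definition point_less ::
  "(nat \<Rightarrow> nat list \<Rightarrow> nat list \<Rightarrow> bool) \<Rightarrow> 'v assignment set \<Rightarrow> nat \<Rightarrow> 'v point \<Rightarrow> 'v point \<Rightarrow> bool"
where
  "point_less prec S m v v' \<longleftrightarrow>
     is_point m v \<and> is_point m v' \<and>
     (\<forall>\<sigma>\<in>S. prec m (map (oeval \<sigma>) v) (map (oeval \<sigma>) v'))"

definition network_less ::
  "('d \<Rightarrow> nat) \<Rightarrow> (nat \<Rightarrow> nat list \<Rightarrow> nat list \<Rightarrow> bool) \<Rightarrow> 'v assignment set \<Rightarrow>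
   ('d, 'v) junction \<Rightarrow> ('d, 'v) junction \<Rightarrow> bool"
where
  "network_less \<A> prec S j j' \<longleftrightarrow>
     point_less prec S (\<A> (fst j)) (snd j) (snd j') \<or> \<A> (fst j') < \<A> (fst j)"

definition jeval :: "'v assignment \<Rightarrow> ('d, 'v) junction \<Rightarrow> ('d, 'v) junction" where
  "jeval \<sigma> j = (fst j, map (\<lambda>t. onum (oeval \<sigma> t)) (snd j))"


text \<open>A flow is a partial map whose domain is the partition, so that two flows are equal iff
  their partitions and their maps on these coincide.\<close>

type_synonym ('d, 'v) flow = "'v assignment set \<rightharpoonup> ('d, 'v) junction set"

definition source :: "('d, 'v) flow \<Rightarrow> ('d, 'v) junction" where
  "source P = (THE j. \<forall>S\<in>dom P. j \<in> the (P S))"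

definition is_flow ::
  "('d \<Rightarrow> nat) \<Rightarrow> (nat \<Rightarrow> nat list \<Rightarrow> nat list \<Rightarrow> bool) \<Rightarrow> ('d, 'v) flow \<Rightarrow> bool"
where
  "is_flow \<A> prec P \<longleftrightarrow>
     partition_on UNIV (dom P) \<and>
     inj_on P (dom P) \<and>
     (\<forall>S\<in>dom P. finite (the (P S)) \<and> the (P S) \<subseteq> junctions \<A>) \<and>
     (\<exists>!j. \<forall>S\<in>dom P. j \<in> the (P S)) \<and>
     (\<forall>S\<in>dom P. \<forall>q\<in>the (P S). network_less \<A> prec S q (source P) \<or> q = source P)"

definition is_call_graph ::
  "('d \<Rightarrow> nat) \<Rightarrow> (nat \<Rightarrow> nat list \<Rightarrow> nat list \<Rightarrow> bool) \<Rightarrow> ('d, 'v) flow set \<Rightarrow> bool"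
where
  "is_call_graph \<A> prec \<G> \<longleftrightarrow>
     finite \<G> \<and>
     (\<forall>P\<in>\<G>. is_flow \<A> prec P) \<and>
     (\<forall>P\<^sub>1\<in>\<G>. \<forall>S\<in>dom P\<^sub>1. \<forall>\<sigma>\<in>S. \<forall>j\<in>the (P\<^sub>1 S).
        \<exists>!P\<^sub>2. P\<^sub>2 \<in> \<G> \<and> (\<exists>\<theta>. jeval \<theta> (source P\<^sub>2) = jeval \<sigma> j))"

definition flow_of ::
  "('d, 'v) flow set \<Rightarrow> ('d, 'v) junction \<Rightarrow> 'v assignment \<Rightarrow> ('d, 'v) flow"
where
  "flow_of \<G> j \<sigma> = (THE P. P \<in> \<G> \<and> (\<exists>\<theta>. jeval \<theta> (source P) = jeval \<sigma> j))"

text \<open>The assignment \<open>\<theta>\<close> is not determined by \<open>j\<close> and \<open>\<sigma>\<close> (for instance on parameters that do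
  not occur in the source), so \<open>subst\<close> may be any function selecting a suitable \<open>\<theta>\<close>.\<close>

definition is_subst ::
  "('d, 'v) flow set \<Rightarrow> (('d, 'v) junction \<Rightarrow> 'v assignment \<Rightarrow> 'v assignment) \<Rightarrow> bool"
where
  "is_subst \<G> subst \<longleftrightarrow>
     (\<forall>P\<in>\<G>. \<forall>S\<in>dom P. \<forall>\<sigma>\<in>S. \<forall>j\<in>the (P S).
        jeval (subst j \<sigma>) (source (flow_of \<G> j \<sigma>)) = jeval \<sigma> j)"

lemma is_subst_exists:
  assumes "is_call_graph \<A> prec \<G>"
  shows "\<exists>subst. is_subst \<G> subst"
proof -
  have "\<exists>\<theta>. jeval \<theta> (source (flow_of \<G> j \<sigma>)) = jeval \<sigma> j"
    if "P \<in> \<G>" "S \<in> dom P" "\<sigma> \<in> S" "j \<in> the (P S)" for P S \<sigma> j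
  proof -
    have "\<exists>!P. P \<in> \<G> \<and> (\<exists>\<theta>. jeval \<theta> (source P) = jeval \<sigma> j)"
      using assms that unfolding is_call_graph_def by blast
    from theI'[OF this] show ?thesis
      unfolding flow_of_def by blast
  qed
  note ex = this
  have "is_subst \<G> (\<lambda>j \<sigma>. SOME \<theta>. jeval \<theta> (source (flow_of \<G> j \<sigma>)) = jeval \<sigma> j)"
    unfolding is_subst_def
    by (intro ballI, rule someI_ex[of "\<lambda>\<theta>. jeval \<theta> (source (flow_of \<G> _ _)) = jeval _ _"], rule ex)
  then show ?thesis
    by blast
qed


text \<open>A codatatype, so that the recursive equation for traces has a solution whether or not the
  recursion terminates; the trees may have infinite depth and infinite branching. Countability of
  the branching is no restriction, as the sets of called junctions are finite.\<close>

codatatype 'j trace = Trace (root: 'j) (subtraces: "'j trace cset")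

definition cell_value :: "('d, 'v) flow \<Rightarrow> 'v assignment \<Rightarrow> ('d, 'v) junction set" where
  "cell_value P \<sigma> = the (P (THE S. S \<in> dom P \<and> \<sigma> \<in> S))"

definition called :: "('d, 'v) flow \<Rightarrow> 'v assignment \<Rightarrow> ('d, 'v) junction set" where
  "called P \<sigma> = cell_value P \<sigma> - {source P}"

primcorec trace_of ::
  "('d, 'v) flow set \<Rightarrow> (('d, 'v) junction \<Rightarrow> 'v assignment \<Rightarrow> 'v assignment) \<Rightarrow>
   ('d, 'v) flow \<Rightarrow> 'v assignment \<Rightarrow> ('d, 'v) junction trace"
where
  "trace_of \<G> subst P \<sigma> =
     Trace (jeval \<sigma> (source P))
       (cimage (\<lambda>j. trace_of \<G> subst (flow_of \<G> j \<sigma>) (subst j \<sigma>)) (acset (called P \<sigma>)))"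

text \<open>The nodes of a tree are the finite paths descending from its root.\<close>

fun is_path :: "'j trace \<Rightarrow> 'j trace list \<Rightarrow> bool" where
  "is_path t [] \<longleftrightarrow> True"
| "is_path t (u # us) \<longleftrightarrow> u \<in> rcset (subtraces t) \<and> is_path u us"

definition finite_tree :: "'j trace \<Rightarrow> bool" where
  "finite_tree t \<longleftrightarrow> finite {us. is_path t us}"

inductive trace_terminates ::
  "('d, 'v) flow set \<Rightarrow> (('d, 'v) junction \<Rightarrow> 'v assignment \<Rightarrow> 'v assignment) \<Rightarrow>
   ('d, 'v) flow \<Rightarrow> 'v assignment \<Rightarrow> bool"
  for \<G> subst
where
  "finite (called P \<sigma>) \<Longrightarrow>
   (\<And>j. j \<in> called P \<sigma> \<Longrightarrow> trace_terminates \<G> subst (flow_of \<G> j \<sigma>) (subst j \<sigma>)) \<Longrightarrow>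
   trace_terminates \<G> subst P \<sigma>"

end

theory Submission
  imports Defs
begin

text \<open>A called junction other than the source either has larger arity than the source, or has the
  same arity and a \<open>prec\<close>-smaller value. Since sources and called junctions agree in value along a
  call, the arities occurring in a branch are those of sources of the finitely many flows, hence
  bounded; so the arity and the value of the source descend in a well-founded lexicographic order.
  As every node has finitely many successors, the tree is finite.\<close>

lemma onum_inj: "onum m = (onum n :: 'v oterm) \<Longrightarrow> m = n"
proof (induction m arbitrary: n)
  case 0
  then show ?case by (cases n) (auto simp: onum_def)
next
  case (Suc m)
  then show ?case by (cases n) (auto simp: onum_def)
qed

text \<open>\<open>jeval\<close> yields junctions of numeral terms, whereas \<open>prec\<close>
  compares lists of naturals. Injectivity of \<open>onum\<close> carries an equality of the former
  over to the latter.\<close>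

lemma jeval_eqD:
  fixes j k :: "('d, 'v) junction"
  assumes "jeval \<theta> j = jeval \<sigma> k"
  shows "fst j = fst k" "map (oeval \<theta>) (snd j) = map (oeval \<sigma>) (snd k)"
proof -
  have "map onum (map (oeval \<theta>) (snd j)) = (map onum (map (oeval \<sigma>) (snd k)) :: 'v oterm list)"
    using assms by (simp add: jeval_def comp_def)
  then show "map (oeval \<theta>) (snd j) = map (oeval \<sigma>) (snd k)"
    by (rule map_injective) (rule injI, rule onum_inj)
  show "fst j = fst k"
    using assms by (simp add: jeval_def)
qed

lemma source_mem:
  assumes "is_flow \<A> prec P" and "S \<in> dom P"
  shows "source P \<in> the (P S)"
proof -
  have "\<exists>!j. \<forall>S\<in>dom P. j \<in> the (P S)"
    using assms(1) by (simp only: is_flow_def)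
  from theI'[OF this] assms(2) show ?thesis
    unfolding source_def by (rule bspec)
qed

text \<open>The description inside \<open>cell_value\<close> denotes, because the cells of a
  partition cover all assignments and are disjoint.\<close>

lemma cell_value_obtain:
  assumes "is_flow \<A> prec P"
  obtains S where "S \<in> dom P" "\<sigma> \<in> S" "cell_value P \<sigma> = the (P S)"
proof -
  have part: "\<Union> (dom P) = UNIV" "disjoint (dom P)"
    using assms by (simp_all add: is_flow_def partition_on_def)
  obtain S where S: "S \<in> dom P" "\<sigma> \<in> S"
    using part(1) by (metis UNIV_I UnionE)
  have "(THE S. S \<in> dom P \<and> \<sigma> \<in> S) = S"
  proof (rule the_equality)
    fix S' assume "S' \<in> dom P \<and> \<sigma> \<in> S'"
    then show "S' = S"
      using part(2) S disjointD[of "dom P" S' S] by auto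
  qed (use S in simp)
  with S that show ?thesis
    by (simp add: cell_value_def)
qed

lemma source_is_point:
  assumes "is_flow \<A> prec P"
  shows "is_point (\<A> (fst (source P))) (snd (source P))"
proof -
  \<comment> \<open>Any cell will do, since the source belongs to the value of every cell; the
    assignment is left open.\<close>
  obtain S where S: "S \<in> dom P"
    by (rule cell_value_obtain[OF assms])
  have "source P \<in> junctions \<A>"
    using source_mem[OF assms S] S assms unfolding is_flow_def by blast
  then show ?thesis
    by (auto simp: junctions_def)
qed

lemma finite_called:
  assumes "is_flow \<A> prec P"
  shows "finite (called P \<sigma>)"
proof -
  obtain S where "S \<in> dom P" "cell_value P \<sigma> = the (P S)"
    by (rule cell_value_obtain[OF assms])
  then show ?thesis
    using assms by (simp add: called_def is_flow_def)
qed

text \<open>The flow condition compares two points under one assignment \<open>\<sigma>\<close>. As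
  \<open>j\<close> under \<open>\<sigma>\<close> has the value of the source of \<open>Q\<close>
  under \<open>\<theta>\<close>, this becomes a comparison of consecutive sources, each under its
  own assignment.\<close>

lemma called_step:
  assumes cg: "is_call_graph \<A> prec \<G>" and sub: "is_subst \<G> subst"
    and P: "P \<in> \<G>" and j: "j \<in> called P \<sigma>"
  defines "Q \<equiv> flow_of \<G> j \<sigma>" and "\<theta> \<equiv> subst j \<sigma>"
  shows "Q \<in> \<G>"
    and "\<A> (fst (source P)) < \<A> (fst (source Q)) \<or>
      \<A> (fst (source Q)) = \<A> (fst (source P)) \<and>
      prec (\<A> (fst (source P)))
        (map (oeval \<theta>) (snd (source Q))) (map (oeval \<sigma>) (snd (source P)))"
proof -
  have fl: "is_flow \<A> prec P"
    using cg P by (simp add: is_call_graph_def)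
  obtain S where S: "S \<in> dom P" "\<sigma> \<in> S" "cell_value P \<sigma> = the (P S)"
    by (rule cell_value_obtain[OF fl])
  have jS: "j \<in> the (P S)" "j \<noteq> source P"
    using j S by (auto simp: called_def)
  have "\<exists>!P. P \<in> \<G> \<and> (\<exists>\<theta>. jeval \<theta> (source P) = jeval \<sigma> j)"
    using cg P S jS unfolding is_call_graph_def by blast
  from theI'[OF this] show "Q \<in> \<G>"
    by (simp add: Q_def flow_of_def)
  have "jeval \<theta> (source Q) = jeval \<sigma> j"
    using sub P S jS unfolding is_subst_def Q_def \<theta>_def by blast
  note eq = jeval_eqD[OF this]
  have less: "network_less \<A> prec S j (source P)"
    using fl S jS unfolding is_flow_def by blast
  show "\<A> (fst (source P)) < \<A> (fst (source Q)) \<or>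
      \<A> (fst (source Q)) = \<A> (fst (source P)) \<and>
      prec (\<A> (fst (source P)))
        (map (oeval \<theta>) (snd (source Q))) (map (oeval \<sigma>) (snd (source P)))"
  proof (cases "\<A> (fst (source P)) < \<A> (fst j)")
    case True
    then show ?thesis by (simp add: eq)
  next
    case False
    then have pl: "point_less prec S (\<A> (fst j)) (snd j) (snd (source P))"
      using less by (simp add: network_less_def)
    \<comment> \<open>\<open>point_less\<close> forces both points to have length
      \<open>\<A> (fst j)\<close>, and the length of the source's point is the arity of its
      symbol.\<close>
    then have "\<A> (fst j) = \<A> (fst (source P))"
      using source_is_point[OF fl] by (simp add: point_less_def is_point_def)
    then show ?thesis
      using pl S(2) by (simp add: eq point_less_def)
  qed
qed

text \<open>The lexicographic descent is split into two nested inductions: an outer one on the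
  distance of the arity from its bound, and an inner one along \<open>prec a\<close> at fixed arity
  \<open>a\<close>.\<close>

lemma call_graph_terminates:
  assumes wf: "\<And>m. wfp_on {xs. length xs = m} (prec m)"
    and cg: "is_call_graph \<A> prec \<G>" and sub: "is_subst \<G> subst"
    and P: "P \<in> \<G>"
  shows "trace_terminates \<G> subst P \<sigma>"
proof -
  define B where "B = Max ((\<lambda>P. \<A> (fst (source P))) ` \<G>)"
  have fin: "finite \<G>" and fl: "is_flow \<A> prec P" if "P \<in> \<G>" for P
    using cg that by (simp_all add: is_call_graph_def)
  have B: "\<A> (fst (source P)) \<le> B" if "P \<in> \<G>" for P
    unfolding B_def using that fin by (intro Max_ge) auto
  have "trace_terminates \<G> subst P \<sigma>" if "P \<in> \<G>" "\<A> (fst (source P)) = a" for a P \<sigma>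
    using that
  proof (induction "B - a" arbitrary: a P \<sigma> rule: less_induct)
    case (less a P \<sigma>)
    \<comment> \<open>Well-foundedness holds relative to lists of length \<open>a\<close>, so the
      inner induction has to start inside that set.\<close>
    have "map (oeval \<sigma>) (snd (source P)) \<in> {xs. length xs = a}"
      using source_is_point[OF fl[OF less.prems(1)]] less.prems(2) by (simp add: is_point_def)
    with wf[of a] show ?case
      using less.prems
    proof (induction "map (oeval \<sigma>) (snd (source P))" arbitrary: P \<sigma>
        rule: wfp_on_induct[consumes 2, case_names step])
      case (step P \<sigma>)
      show ?case
      proof (rule trace_terminates.intros)
        show "finite (called P \<sigma>)"
          by (rule finite_called[OF fl[OF step.prems(1)]])
      next
        fix j assume j: "j \<in> called P \<sigma>"
        let ?Q = "flow_of \<G> j \<sigma>" and ?\<theta> = "subst j \<sigma>"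
        note call = called_step[OF cg sub step.prems(1) j]
        from call(2) show "trace_terminates \<G> subst ?Q ?\<theta>"
        proof (elim disjE conjE)
          assume "\<A> (fst (source P)) < \<A> (fst (source ?Q))"
          \<comment> \<open>Subtraction is truncated; the decrease is strict because the larger
            arity still does not exceed \<open>B\<close>.\<close>
          then have "B - \<A> (fst (source ?Q)) < B - a"
            using B[OF call(1)] step.prems(2) by simp
          then show ?thesis
            using less.hyps call(1) by blast
        next
          assume eq: "\<A> (fst (source ?Q)) = \<A> (fst (source P))"
            and "prec (\<A> (fst (source P)))
              (map (oeval ?\<theta>) (snd (source ?Q))) (map (oeval \<sigma>) (snd (source P)))"
          \<comment> \<open>The inner induction hypothesis covers only values in the set of lists of
            length \<open>a\<close>.\<close>
          moreover have "length (snd (source ?Q)) = \<A> (fst (source ?Q))"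
            using source_is_point[OF fl[OF call(1)]] by (simp add: is_point_def)
          ultimately show ?thesis
            using step.hyps call(1) step.prems(2) by simp
        qed
      qed
    qed
  qed
  then show ?thesis
    using P by blast
qed

text \<open>A path is empty or consists of a child \<open>u\<close> and a path from
  \<open>u\<close>, so the paths lie in a finite union of finite sets.\<close>

lemma finite_treeI:
  assumes fin: "finite (rcset (subtraces t))"
    and sub: "\<And>u. u \<in> rcset (subtraces t) \<Longrightarrow> finite_tree u"
  shows "finite_tree t"
proof -
  have "{us. is_path t us} \<subseteq>
      insert [] (\<Union>u\<in>rcset (subtraces t). (#) u ` {us. is_path u us})"
  proof
    fix us assume "us \<in> {us. is_path t us}"
    then show "us \<in> insert [] (\<Union>u\<in>rcset (subtraces t). (#) u ` {us. is_path u us})"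
      by (cases us) auto
  qed
  moreover have "finite \<dots>"
    using fin sub by (auto simp: finite_tree_def)
  ultimately show ?thesis
    unfolding finite_tree_def by (rule finite_subset)
qed

lemma trace_terminates_finite_tree:
  assumes "trace_terminates \<G> subst P \<sigma>"
  shows "finite_tree (trace_of \<G> subst P \<sigma>)"
  using assms
proof induction
  case (1 P \<sigma>)
  \<comment> \<open>\<open>acset\<close> is inverted by \<open>rcset\<close> only on countable sets;
    the finiteness premise of \<open>trace_terminates\<close> supplies this.\<close>
  have "rcset (subtraces (trace_of \<G> subst P \<sigma>)) =
      (\<lambda>j. trace_of \<G> subst (flow_of \<G> j \<sigma>) (subst j \<sigma>)) ` called P \<sigma>"
    using 1(1) by (simp add: cimage.rep_eq countable_finite)
  with 1 show ?case
    by (intro finite_treeI[of "trace_of \<G> subst P \<sigma>"]) auto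
qed

theorem theorem1:
  fixes \<A> :: "'d \<Rightarrow> nat"
    and prec :: "nat \<Rightarrow> nat list \<Rightarrow> nat list \<Rightarrow> bool"
    and \<G> :: "('d, 'v) flow set"
    and subst :: "('d, 'v) junction \<Rightarrow> 'v assignment \<Rightarrow> 'v assignment"
    and P :: "('d, 'v) flow"
    and \<sigma> :: "'v assignment"
  assumes "countable (UNIV :: 'd set)" and "infinite (UNIV :: 'd set)"
    and "\<And>m. wf_total_order_on {xs. length xs = m} (prec m)"
    and "is_call_graph \<A> prec \<G>"
    and "is_subst \<G> subst"
    and "P \<in> \<G>"
  shows "finite_tree (trace_of \<G> subst P \<sigma>) \<and> trace_terminates \<G> subst P \<sigma>"
proof -
  have "trace_terminates \<G> subst P \<sigma>"
    using assms(3-6) by (intro call_graph_terminates) (auto simp: wf_total_order_on_def)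
  then show ?thesis
    by (simp add: trace_terminates_finite_tree)
qed

end
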